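(* Let $n\geq 3$ and let $G$ be an edge-colored $K^{(3)}_{n,n,n}$ with partite sets $V_1,V_2,V_3$, containing no rainbow copy of $\mathcal{L}$, with $|C(G)|\geq 3$. Then, after renumbering the colors if necessary, at least one of the following holds: (i) there exist two vertices $x_1,y_1$ and a color $i\in C(G)$ such that every edge $e$ with $c(e)\neq i$ satisfies $\{x_1,y_1\}\subseteq e$; (ii) $|C(G)|=3$, and there is a unique edge $e$ of color $1$, and every edge $f$ of color $2$ satisfies $|e\cap f|=2$; (iii) $|C(G)|=3$, and there exist five vertices $x_1,y_1,y_2,z_1,z_2$ such that $c(x_1y_1z_1)=c(x_1y_2z_2)=1$, $c(x_1y_1z_2)=c(x_1y_2z_1)=2$, and all remaining edges have color $3$.
   Context: $K^{(3)}_{n,n,n}$ with partite sets $V_1,V_2,V_3$ (disjoint, each of size $n$) is the 3-graph whose edges are all $\{x,y,z\}$ with $x\in V_1,y\in V_2,z\in V_3$. An edge-coloring is any map $c$ from edges to colors; $C(G)$ is the set of colors used; a copy is rainbow if its edges have pairwise distinct colors. The loose path $\mathcal{L}$ is the 3-graph with edges $\{v_1v_2v_3,v_3v_4v_5,v_5v_6v_7\}$. *)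

theory Defs
  imports Main
begin

definition complete_tripartite :: "'v set \<Rightarrow> 'v set \<Rightarrow> 'v set \<Rightarrow> 'v set set" where
  "complete_tripartite V1 V2 V3 = {{x, y, z} | x y z. x \<in> V1 \<and> y \<in> V2 \<and> z \<in> V3}"

definition colors :: "('v set \<Rightarrow> 'c) \<Rightarrow> 'v set set \<Rightarrow> 'c set" where
  "colors c E = c ` E"

definition loose_path :: "nat set set" where
  "loose_path = {{1, 2, 3}, {3, 4, 5}, {5, 6, 7}}"

text \<open>A hypergraph without isolated vertices is given by its edge set \<open>H\<close>, with vertex set \<open>\<Union>H\<close>;
  a copy of \<open>H\<close> in \<open>E\<close> is given by an injective map of the vertices taking edges to edges.\<close>

definition is_copy :: "'w set set \<Rightarrow> 'v set set \<Rightarrow> ('w \<Rightarrow> 'v) \<Rightarrow> bool" where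
  "is_copy H E \<phi> \<longleftrightarrow> inj_on \<phi> (\<Union>H) \<and> (\<forall>e\<in>H. \<phi> ` e \<in> E)"

definition has_rainbow_copy :: "'w set set \<Rightarrow> 'v set set \<Rightarrow> ('v set \<Rightarrow> 'c) \<Rightarrow> bool" where
  "has_rainbow_copy H E c \<longleftrightarrow> (\<exists>\<phi>. is_copy H E \<phi> \<and> inj_on c ((`) \<phi> ` H))"

end

theory Submission
  imports Defs
begin

text \<open>
  Call two edges adjacent if they share two vertices. The key fact is that, if \<open>A\<close> and \<open>C\<close> are disjoint
  edges of different colours, every edge of a third colour is adjacent to \<open>A\<close> or to \<open>C\<close>. Two edges
  always have a common disjoint edge, and an edge adjacent to \<open>A\<close> is not adjacent to an edge disjoint
  from \<open>A\<close>; so the key fact yields a dominant colour \<open>i\<close> that occurs in every disjoint pair with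
  two colours. If \<open>A\<close> and \<open>B\<close> have different colours other than \<open>i\<close>, an edge disjoint from both must have
  colour \<open>i\<close>, and the key fact makes \<open>A\<close> and \<open>B\<close> adjacent. Hence the colour classes other than \<open>i\<close> are
  pairwise completely adjacent: either they all contain a fixed pair of vertices, or there are two of
  them, and one is a single edge or they form a 4-cycle of adjacent edges.
\<close>

section \<open>Edges coded as triples: shared vertices, lines and common neighbours\<close>

definition agree :: "'a \<times> 'b \<times> 'c \<Rightarrow> 'a \<times> 'b \<times> 'c \<Rightarrow> nat" where
  "agree = (\<lambda>(x, y, z) (x', y', z'). of_bool (x = x') + of_bool (y = y') + of_bool (z = z'))"

lemma agree_triple [simp]:
  "agree (x, y, z) (x', y', z') = of_bool (x = x') + of_bool (y = y') + of_bool (z = z')"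
  by (simp add: agree_def)

lemma agree_eq_iffs:
  "agree (x, y, z) (x', y', z') = 0 \<longleftrightarrow> x \<noteq> x' \<and> y \<noteq> y' \<and> z \<noteq> z'"
  "agree (x, y, z) (x', y', z') = 1 \<longleftrightarrow>
     x = x' \<and> y \<noteq> y' \<and> z \<noteq> z' \<or> x \<noteq> x' \<and> y = y' \<and> z \<noteq> z' \<or> x \<noteq> x' \<and> y \<noteq> y' \<and> z = z'"
  "agree (x, y, z) (x', y', z') = 2 \<longleftrightarrow>
     x = x' \<and> y = y' \<and> z \<noteq> z' \<or> x = x' \<and> y \<noteq> y' \<and> z = z' \<or> x \<noteq> x' \<and> y = y' \<and> z = z'"
  by (auto simp: of_bool_def)

lemma agree_commute: "agree p q = agree q p"
  by (cases p; cases q) (auto simp: eq_commute)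

lemma agree_eq_3_iff: "agree p q = 3 \<longleftrightarrow> p = q"
  by (cases p; cases q) (auto simp: of_bool_def)

lemma agree_le_3: "agree p q \<le> 3"
  by (cases p; cases q) (auto simp: of_bool_def)

text \<open>Passing from \<open>q\<close> to \<open>p\<close> changes a single coordinate, so only
  in that coordinate can \<open>p\<close> share a vertex with \<open>r\<close>.\<close>

lemma not_adjacent_if_disjoint:
  assumes "agree p q = 2" "agree q r = 0"
  shows "agree p r < 2"
  using assms by (cases p; cases q; cases r) (auto simp: of_bool_def split: if_splits)

text \<open>For adjacent \<open>p\<close> and \<open>q\<close> this is the axis-parallel line of the
  grid through them, which encodes the edges containing a fixed pair of vertices.\<close>

definition on_line :: "'a \<times> 'b \<times> 'c \<Rightarrow> 'a \<times> 'b \<times> 'c \<Rightarrow> 'a \<times> 'b \<times> 'c \<Rightarrow> bool" where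
  "on_line = (\<lambda>(x, y, z) (x', y', z') (u, v, w).
     (x = x' \<longrightarrow> u = x) \<and> (y = y' \<longrightarrow> v = y) \<and> (z = z' \<longrightarrow> w = z))"

lemma on_line_triple [simp]:
  "on_line (x, y, z) (x', y', z') (u, v, w) \<longleftrightarrow>
     (x = x' \<longrightarrow> u = x) \<and> (y = y' \<longrightarrow> v = y) \<and> (z = z' \<longrightarrow> w = z)"
  by (simp add: on_line_def)

lemma on_line_endpoints: "on_line p q p" "on_line p q q"
  by (cases p; cases q; simp)+

text \<open>If \<open>r\<close> differed from \<open>p\<close> in another coordinate than
  \<open>q\<close> does, it would differ from \<open>q\<close> in two.\<close>

lemma on_line_if_adjacent:
  assumes "agree p q = 2" "agree p r = 2" "agree q r = 2"
  shows "on_line p q r"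
  using assms by (cases p; cases q; cases r) (simp only: agree_eq_iffs on_line_triple; blast)

text \<open>Two distinct points determine their line: \<open>r\<close> and \<open>s\<close> differ
  exactly in the free coordinate of the line through \<open>p\<close> and \<open>q\<close>.\<close>

lemma on_line_trans:
  assumes "agree p q = 2" "on_line p q r" "on_line p q s" "r \<noteq> s" "on_line r s t"
  shows "on_line p q t"
  using assms
  by (cases p; cases q; cases r; cases s; cases t) (simp only: agree_eq_iffs on_line_triple prod.inject; metis)

text \<open>A common neighbour takes one of the two differing coordinates from \<open>p\<close> and
  the other from \<open>q\<close>. There are just two such mixtures, and with \<open>p\<close> and
  \<open>q\<close> they form a 4-cycle.\<close>

lemma common_neighbours_unique:
  assumes "agree p q = 1" "r \<noteq> s"
    and "agree p r = 2" "agree q r = 2" "agree p s = 2" "agree q s = 2" "agree p t = 2" "agree q t = 2"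
  shows "t = r \<or> t = s"
  using assms
  by (cases p; cases q; cases r; cases s; cases t) (simp only: agree_eq_iffs prod.inject; metis)

lemma adjacent_if_on_line:
  assumes "agree p q = 2" "on_line p q r" "on_line p q s" "r \<noteq> s"
  shows "agree r s = 2"
  using assms
  by (cases p; cases q; cases r; cases s) (simp only: agree_eq_iffs on_line_triple prod.inject; metis)

text \<open>Triangle inequality: \<open>p\<close> and \<open>q\<close> each change one coordinate of
  \<open>r\<close>, so they differ in at most two.\<close>

lemma agree_if_common_neighbour:
  assumes "agree p r = 2" "agree q r = 2" "p \<noteq> q"
  shows "agree p q = 1 \<or> agree p q = 2"
  using assms
  by (cases p; cases q; cases r) (simp only: agree_eq_iffs prod.inject; metis)

lemma common_neighbours_cases:
  assumes "agree (x, y, z) (x', y', z') = 1" "r \<noteq> s"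
    and "agree (x, y, z) r = 2" "agree (x', y', z') r = 2" "agree (x, y, z) s = 2" "agree (x', y', z') s = 2"
  obtains "x = x'" "y \<noteq> y'" "z \<noteq> z'" "{r, s} = {(x, y, z'), (x, y', z)}"
    | "y = y'" "x \<noteq> x'" "z \<noteq> z'" "{r, s} = {(x, y, z'), (x', y, z)}"
    | "z = z'" "x \<noteq> x'" "y \<noteq> y'" "{r, s} = {(x, y', z), (x', y, z)}"
proof -
  have *: "{r, s} = {t, t'}" if "r \<in> {t, t'}" "s \<in> {t, t'}" for t t'
    using that \<open>r \<noteq> s\<close> by auto
  consider "x = x'" "y \<noteq> y'" "z \<noteq> z'" | "x \<noteq> x'" "y = y'" "z \<noteq> z'" | "x \<noteq> x'" "y \<noteq> y'" "z = z'"
    using assms(1) unfolding agree_eq_iffs by blast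
  then show thesis
  proof cases
    case 1
    have "t \<in> {(x, y, z'), (x, y', z)}" if "agree (x, y, z) t = 2" "agree (x', y', z') t = 2" for t
      using that 1 by (cases t) (auto simp only: agree_eq_iffs)
    with 1 show thesis using that(1) * assms by blast
  next
    case 2
    have "t \<in> {(x, y, z'), (x', y, z)}" if "agree (x, y, z) t = 2" "agree (x', y', z') t = 2" for t
      using that 2 by (cases t) (auto simp only: agree_eq_iffs)
    with 2 show thesis using that(2) * assms by blast
  next
    case 3
    have "t \<in> {(x, y', z), (x', y, z)}" if "agree (x, y, z) t = 2" "agree (x', y', z') t = 2" for t
      using that 3 by (cases t) (auto simp only: agree_eq_iffs)
    with 3 show thesis using that(3) * assms by blast
  qed
qed

section \<open>Colourings of a product of three sets without a rainbow loose path\<close>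

lemma third_element:
  assumes "card S \<ge> 3"
  shows "\<exists>s\<in>S. s \<noteq> a \<and> s \<noteq> b"
proof (rule ccontr)
  assume "\<not> ?thesis"
  then have "card S \<le> card {a, b}" by (intro card_mono) auto
  also have "\<dots> \<le> 2" by (simp add: card_insert_if)
  finally show False using assms by simp
qed

text \<open>In \<open>no_loose_path\<close> the middle edge of the path is \<open>q\<close>.
  Separate types for the coordinates build in the disjointness of the partite sets and let two parts
  be exchanged by a new instance.\<close>

locale loose_path_free =
  fixes X :: "'a set" and Y :: "'b set" and Z :: "'c set" and h :: "'a \<times> 'b \<times> 'c \<Rightarrow> 'd"
  assumes card_ge: "card X \<ge> 3" "card Y \<ge> 3" "card Z \<ge> 3"
    and no_loose_path: "\<lbrakk>p \<in> X \<times> Y \<times> Z; q \<in> X \<times> Y \<times> Z; r \<in> X \<times> Y \<times> Z;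
      agree p q = 1; agree q r = 1; agree p r = 0; h p \<noteq> h q; h q \<noteq> h r\<rbrakk> \<Longrightarrow> h p = h r"
begin

definition T :: "('a \<times> 'b \<times> 'c) set" where "T = X \<times> Y \<times> Z"

text \<open>Together with \<open>swap_13\<close> this reduces claims that single out one coordinate
  to the first coordinate.\<close>

lemma swap_12: "loose_path_free Y X Z (\<lambda>(y, x, z). h (x, y, z))"
proof
  fix p q r :: "'b \<times> 'a \<times> 'c"
  assume *: "p \<in> Y \<times> X \<times> Z" "q \<in> Y \<times> X \<times> Z" "r \<in> Y \<times> X \<times> Z"
    "agree p q = 1" "agree q r = 1" "agree p r = 0"
    "(\<lambda>(y, x, z). h (x, y, z)) p \<noteq> (\<lambda>(y, x, z). h (x, y, z)) q"
    "(\<lambda>(y, x, z). h (x, y, z)) q \<noteq> (\<lambda>(y, x, z). h (x, y, z)) r"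
  obtain p1 p2 p3 q1 q2 q3 r1 r2 r3 where "p = (p1, p2, p3)" "q = (q1, q2, q3)" "r = (r1, r2, r3)"
    by (metis prod_cases3)
  then show "(\<lambda>(y, x, z). h (x, y, z)) p = (\<lambda>(y, x, z). h (x, y, z)) r"
    using * no_loose_path[of "(p2, p1, p3)" "(q2, q1, q3)" "(r2, r1, r3)"]
    by (simp add: add_ac)
qed (use card_ge in auto)

lemma swap_13: "loose_path_free Z Y X (\<lambda>(z, y, x). h (x, y, z))"
proof
  fix p q r :: "'c \<times> 'b \<times> 'a"
  assume *: "p \<in> Z \<times> Y \<times> X" "q \<in> Z \<times> Y \<times> X" "r \<in> Z \<times> Y \<times> X"
    "agree p q = 1" "agree q r = 1" "agree p r = 0"
    "(\<lambda>(z, y, x). h (x, y, z)) p \<noteq> (\<lambda>(z, y, x). h (x, y, z)) q"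
    "(\<lambda>(z, y, x). h (x, y, z)) q \<noteq> (\<lambda>(z, y, x). h (x, y, z)) r"
  obtain p1 p2 p3 q1 q2 q3 r1 r2 r3 where "p = (p1, p2, p3)" "q = (q1, q2, q3)" "r = (r1, r2, r3)"
    by (metis prod_cases3)
  then show "(\<lambda>(z, y, x). h (x, y, z)) p = (\<lambda>(z, y, x). h (x, y, z)) r"
    using * no_loose_path[of "(p3, p2, p1)" "(q3, q2, q1)" "(r3, r2, r1)"]
    by (simp add: add_ac)
qed (use card_ge in auto)

lemma ex_disjoint: "\<exists>r\<in>T. agree p r = 0 \<and> agree q r = 0"
proof -
  obtain p1 p2 p3 q1 q2 q3 where [simp]: "p = (p1, p2, p3)" "q = (q1, q2, q3)"
    by (metis prod_cases3)
  obtain x y z where "x \<in> X" "x \<noteq> p1" "x \<noteq> q1" "y \<in> Y" "y \<noteq> p2" "y \<noteq> q2" "z \<in> Z" "z \<noteq> p3" "z \<noteq> q3"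
    using card_ge third_element by meson
  then show ?thesis by (intro bexI[of _ "(x, y, z)"]) (auto simp: T_def)
qed

section \<open>A third colour beside a disjoint pair\<close>

lemma not_rainbow:
  "\<lbrakk>p \<in> T; q \<in> T; r \<in> T; agree p q = 1; agree q r = 1; agree p r = 0\<rbrakk>
    \<Longrightarrow> h p = h q \<or> h q = h r \<or> h p = h r"
  using no_loose_path unfolding T_def by blast

text \<open>Each new edge is put on two loose paths whose other edges carry two different pairs of
  the three given colours, so it must have the colour common to both pairs. Six colours forced in
  this way end in a rainbow path.\<close>

lemma no_rainbow_meeting_in_first:
  assumes "x0 \<in> X" "x1 \<in> X" "y0 \<in> Y" "y1 \<in> Y" "y2 \<in> Y" "z0 \<in> Z" "z1 \<in> Z" "z2 \<in> Z"
    and "x0 \<noteq> x1" "y0 \<noteq> y1" "y0 \<noteq> y2" "y1 \<noteq> y2" "z0 \<noteq> z1" "z0 \<noteq> z2" "z1 \<noteq> z2"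
    and col: "h (x0, y0, z0) \<noteq> h (x1, y1, z1)" "h (x0, y0, z0) \<noteq> h (x0, y2, z2)"
      "h (x1, y1, z1) \<noteq> h (x0, y2, z2)"
  shows False
proof -
  obtain x2 where "x2 \<in> X" "x2 \<noteq> x0" "x2 \<noteq> x1"
    using third_element card_ge by meson
  note mem = assms(1-15) this this(2,3)[symmetric] assms(9-15)[symmetric]
  have 1: "h (x2, y1, z2) = h (x0, y2, z2)"
    using not_rainbow[of "(x0,y0,z0)" "(x0,y2,z2)" "(x2,y1,z2)"]
      not_rainbow[of "(x0,y2,z2)" "(x2,y1,z2)" "(x1,y1,z1)"] mem col by (auto simp: T_def)
  have 2: "h (x1, y2, z0) = h (x1, y1, z1)"
    using not_rainbow[of "(x0,y2,z2)" "(x1,y2,z0)" "(x1,y1,z1)"]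
      not_rainbow[of "(x0,y0,z0)" "(x1,y2,z0)" "(x1,y1,z1)"] mem col by (auto simp: T_def)
  have 3: "h (x2, y2, z0) = h (x0, y2, z2)"
    using not_rainbow[of "(x0,y0,z0)" "(x2,y2,z0)" "(x2,y1,z2)"]
      not_rainbow[of "(x1,y1,z1)" "(x2,y1,z2)" "(x2,y2,z0)"] mem col 1 by (auto simp: T_def)
  have 4: "h (x1, y0, z1) = h (x0, y2, z2)"
    using not_rainbow[of "(x0,y2,z2)" "(x0,y0,z0)" "(x1,y0,z1)"]
      not_rainbow[of "(x0,y2,z2)" "(x1,y2,z0)" "(x1,y0,z1)"] mem col 2 by (auto simp: T_def)
  have 5: "h (x0, y1, z2) = h (x0, y0, z0)"
    using not_rainbow[of "(x0,y0,z0)" "(x0,y1,z2)" "(x1,y1,z1)"]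
      not_rainbow[of "(x0,y1,z2)" "(x0,y0,z0)" "(x2,y2,z0)"] mem col 3 by (auto simp: T_def)
  have 6: "h (x0, y2, z1) = h (x1, y1, z1)"
    using not_rainbow[of "(x0,y2,z1)" "(x1,y1,z1)" "(x2,y1,z2)"]
      not_rainbow[of "(x0,y0,z0)" "(x0,y2,z1)" "(x1,y1,z1)"] mem col 1 by (auto simp: T_def)
  \<comment> \<open>Along this path the colours are those of \<open>(x0, y0, z0)\<close>,
    \<open>(x1, y1, z1)\<close> and \<open>(x0, y2, z2)\<close>, by facts 5, 6 and 4.\<close>
  show False
    using not_rainbow[of "(x0,y1,z2)" "(x0,y2,z1)" "(x1,y0,z1)"] mem col 4 5 6 by (auto simp: T_def)
qed

lemma no_rainbow_meeting_once:
  assumes "p \<in> T" "q \<in> T" "r \<in> T" "agree p q = 0" "agree r p = 1" "agree r q = 0"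
    and "h p \<noteq> h q" "h p \<noteq> h r" "h q \<noteq> h r"
  shows False
proof -
  obtain p1 p2 p3 q1 q2 q3 r1 r2 r3 where
    [simp]: "p = (p1, p2, p3)" "q = (q1, q2, q3)" "r = (r1, r2, r3)"
    by (metis prod_cases3)
  consider "r1 = p1" "r2 \<noteq> p2" "r3 \<noteq> p3" | "r2 = p2" "r1 \<noteq> p1" "r3 \<noteq> p3" | "r3 = p3" "r1 \<noteq> p1" "r2 \<noteq> p2"
    using assms(5) by (auto simp: of_bool_def split: if_splits)
  then show False
  proof cases
    case 1
    then show False
      using no_rainbow_meeting_in_first[of p1 q1 p2 q2 r2 p3 q3 r3] assms by (auto simp: T_def)
  next
    case 2
    then show False
      using loose_path_free.no_rainbow_meeting_in_first[OF swap_12, of p2 q2 p1 q1 r1 p3 q3 r3] assms by (auto simp: T_def)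
  next
    case 3
    then show False
      using loose_path_free.no_rainbow_meeting_in_first[OF swap_13, of p3 q3 p2 q2 r2 p1 q1 r1] assms by (auto simp: T_def)
  qed
qed

lemma no_rainbow_matching:
  assumes "p \<in> T" "q \<in> T" "r \<in> T" "agree p q = 0" "agree p r = 0" "agree q r = 0"
    and "h p \<noteq> h q" "h p \<noteq> h r" "h q \<noteq> h r"
  shows False
proof -
  obtain p1 p2 p3 q1 q2 q3 r1 r2 r3 where
    [simp]: "p = (p1, p2, p3)" "q = (q1, q2, q3)" "r = (r1, r2, r3)"
    by (metis prod_cases3)
  \<comment> \<open>One coordinate from each edge gives the middle of a loose path between any two
    of them. Its colour would have to lie in each of the three pairs of colours, which have no
    common element.\<close>
  let ?m = "(p1, q2, r3)"
  have *: "?m \<in> T" "agree p ?m = 1" "agree q ?m = 1" "agree r ?m = 1" "agree ?m p = 1" "agree ?m q = 1" "agree ?m r = 1"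
    using assms by (auto simp: T_def of_bool_def split: if_splits)
  show False
    using not_rainbow[of p ?m q] not_rainbow[of p ?m r] not_rainbow[of q ?m r] assms * by metis
qed

text \<open>A third edge adjacent to neither shares at most one vertex with each. Then the three
  edges form a matching, or \<open>r\<close> meets exactly one of the other two, or \<open>r\<close>
  is the middle of a rainbow path.\<close>

lemma third_colour_adjacent:
  assumes "p \<in> T" "q \<in> T" "r \<in> T" "agree p q = 0" "h p \<noteq> h q" "h p \<noteq> h r" "h q \<noteq> h r"
  shows "agree r p = 2 \<or> agree r q = 2"
proof (rule ccontr)
  assume no: "\<not> ?thesis"
  have "agree r p \<noteq> 3" "agree r q \<noteq> 3"
    using assms agree_eq_3_iff by metis+
  then have "agree r p \<in> {0, 1}" "agree r q \<in> {0, 1}"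
    using no agree_le_3[of r p] agree_le_3[of r q] by auto
  then consider "agree r p = 0" "agree r q = 0" | "agree r p = 1" "agree r q = 0"
    | "agree r p = 0" "agree r q = 1" | "agree r p = 1" "agree r q = 1" by auto
  then show False
  proof cases
    case 1
    then show False using no_rainbow_matching[of p q r] assms agree_commute by metis
  next
    case 2
    then show False using no_rainbow_meeting_once[of p q r] assms by metis
  next
    case 3
    then show False using no_rainbow_meeting_once[of q p r] assms agree_commute by metis
  next
    case 4
    then show False using not_rainbow[of p r q] assms agree_commute by metis
  qed
qed

section \<open>The dominant colour\<close>

lemma no_adjacent_on_both_sides:
  assumes "p \<in> T" "q \<in> T" "e \<in> T" "f \<in> T" "agree p q = 0"
    and "h p \<noteq> h q" "h p \<noteq> h e" "h q \<noteq> h e" "h f \<noteq> h q"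
    and "agree e p = 2" "agree f q = 2" "h f = h p \<Longrightarrow> agree e f \<noteq> 2"
  shows False
proof -
  \<comment> \<open>Otherwise \<open>q\<close> and \<open>g\<close> are a disjoint pair of two
    colours with neither \<open>p\<close> nor \<open>e\<close> adjacent to one of them. Both would
    then have the colour of \<open>g\<close>, but their colours differ.\<close>
  have key: "h g = h q" if "g \<in> T" "agree q g = 0" "agree g p \<noteq> 2" "g \<noteq> p" "agree g e \<noteq> 2" "g \<noteq> e" for g
  proof (rule ccontr)
    assume "h g \<noteq> h q"
    moreover have "agree p q \<noteq> 2" "agree e q \<noteq> 2"
      using assms(5) not_adjacent_if_disjoint[OF assms(10,5)] by auto
    ultimately show False
      using third_colour_adjacent[of q g p] third_colour_adjacent[of q g e] assms that
      by (metis agree_commute)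
  qed
  show False
  proof (cases "h f = h p")
    case True
    \<comment> \<open>By \<open>key\<close> this \<open>g\<close> has the colour of
      \<open>q\<close>, so \<open>f\<close> has a third colour beside the disjoint pair
      \<open>e\<close>, \<open>g\<close>. It is not adjacent to \<open>e\<close> by the last
      hypothesis, nor to \<open>g\<close>, since it is adjacent to \<open>q\<close>, which is
      disjoint from \<open>g\<close>.\<close>
    obtain g where g: "g \<in> T" "agree q g = 0" "agree e g = 0" using ex_disjoint by blast
    have "agree p g < 2"
      using not_adjacent_if_disjoint[of p e g] assms g by (metis agree_commute)
    moreover have "agree f g < 2"
      using not_adjacent_if_disjoint[of f q g] assms g by metis
    ultimately have ag: "agree g p \<noteq> 2" "agree g e \<noteq> 2" "agree f g \<noteq> 2" "g \<noteq> p" "g \<noteq> e"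
      using g agree_eq_3_iff[of p g] agree_eq_3_iff[of e g] agree_commute[of g] by auto
    then have "h g = h q" using key g by blast
    then show False
      using third_colour_adjacent[of e g f] assms True g ag by (metis agree_commute)
  next
    case False
    \<comment> \<open>Now \<open>f\<close> has a third colour beside the disjoint pair
      \<open>p\<close>, \<open>g\<close>. It is adjacent to \<open>q\<close>, hence to neither of
      these edges disjoint from \<open>q\<close>.\<close>
    obtain g where g: "g \<in> T" "agree q g = 0" "agree p g = 0" using ex_disjoint by blast
    have "agree e g < 2"
      using not_adjacent_if_disjoint[of e p g] assms g by (metis agree_commute)
    moreover have "agree f g < 2" "agree f p < 2"
      using not_adjacent_if_disjoint[of f q g] not_adjacent_if_disjoint[of f q p] assms g
      by (metis agree_commute)+
    ultimately have ag: "agree g p \<noteq> 2" "agree g e \<noteq> 2" "agree f g \<noteq> 2" "g \<noteq> p" "g \<noteq> e" "agree f p \<noteq> 2"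
      using g agree_eq_3_iff[of p g] agree_eq_3_iff[of e g] agree_commute[of g] by auto
    then have "h g = h q" using key g by blast
    then show False
      using third_colour_adjacent[of p g f] assms False g ag by (metis agree_commute)
  qed
qed

text \<open>An edge adjacent to \<open>q\<close> has the colour of \<open>p\<close> or of
  \<open>q\<close>. In a disjoint pair of two colours avoiding that of \<open>q\<close>, one edge
  would be adjacent to \<open>q\<close> and so coloured like \<open>p\<close>; the other would have
  a third colour and be adjacent to \<open>p\<close>, which \<open>no_adjacent_on_both_sides\<close>
  excludes.\<close>

lemma dominant_if_third_colour_adjacent:
  assumes "p \<in> T" "q \<in> T" "d \<in> T" "agree p q = 0" "h p \<noteq> h q" "h p \<noteq> h d" "h q \<noteq> h d"
    and "agree d p = 2" and "e \<in> T" "f \<in> T" "agree e f = 0" "h e \<noteq> h f"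
  shows "h e = h q \<or> h f = h q"
proof (rule ccontr)
  have far: "h u = h p" if "u \<in> T" "agree u q = 2" "h u \<noteq> h q" for u
    using no_adjacent_on_both_sides[of p q d u] assms that by metis
  have False if ef: "e \<in> T" "f \<in> T" "agree e f = 0" "h e \<noteq> h f" "h e \<noteq> h q" "h f \<noteq> h q" "agree q f = 2" for e f
  proof -
    have f: "agree f q = 2" "h f = h p" using far ef agree_commute by metis+
    then have "h e \<noteq> h p" using ef by metis
    then have "agree e p = 2"
      using third_colour_adjacent[of p q e] far assms ef by metis
    then show False
      using no_adjacent_on_both_sides[of p q e f] assms ef f \<open>h e \<noteq> h p\<close> by force
  qed
  moreover assume "\<not> ?thesis"
  ultimately show False
    using third_colour_adjacent[of e f q] assms by (metis agree_commute)
qed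

lemma dominant_colour:
  assumes "a \<in> T" "b \<in> T" "d \<in> T" "h a \<noteq> h b" "h a \<noteq> h d" "h b \<noteq> h d"
  shows "\<exists>i\<in>h ` T. \<forall>e\<in>T. \<forall>f\<in>T. agree e f = 0 \<longrightarrow> h e \<noteq> h f \<longrightarrow> h e = i \<or> h f = i"
proof -
  obtain g where "g \<in> T" "agree a g = 0" "agree b g = 0" using ex_disjoint by blast
  \<comment> \<open>The colour of \<open>g\<close> differs from that of \<open>a\<close> or that of
    \<open>b\<close>.\<close>
  then obtain p q where pq: "p \<in> T" "q \<in> T" "agree p q = 0" "h p \<noteq> h q"
    using assms by metis
  then obtain r where r: "r \<in> T" "h p \<noteq> h r" "h q \<noteq> h r"
    using assms by metis
  then consider "agree r p = 2" | "agree r q = 2"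
    using third_colour_adjacent pq by metis
  then show ?thesis
  proof cases
    case 1
    show ?thesis
      using dominant_if_third_colour_adjacent[of p q r] pq r 1 by (intro bexI[of _ "h q"]) auto
  next
    case 2
    show ?thesis
      using dominant_if_third_colour_adjacent[of q p r] pq r 2 agree_commute[of q p]
      by (intro bexI[of _ "h p"]) auto
  qed
qed

section \<open>The colour classes other than the dominant one\<close>

lemma nondominant_adjacent:
  assumes dom: "\<forall>e\<in>T. \<forall>f\<in>T. agree e f = 0 \<longrightarrow> h e \<noteq> h f \<longrightarrow> h e = i \<or> h f = i"
    and "p \<in> T" "q \<in> T" "h p \<noteq> h q" "h p \<noteq> i" "h q \<noteq> i"
  shows "agree p q = 2"
proof -
  obtain g where g: "g \<in> T" "agree p g = 0" "agree q g = 0" using ex_disjoint by blast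
  \<comment> \<open>Any colour other than \<open>i\<close> would have to be both that of
    \<open>p\<close> and that of \<open>q\<close>, because \<open>g\<close> is disjoint from
    both.\<close>
  then have "h g = i" using dom assms by metis
  then show ?thesis
    using third_colour_adjacent[of p g q] assms g agree_commute[of p q] by auto
qed

lemma classification:
  assumes "card (h ` T) \<ge> 3"
  shows "(\<exists>p\<in>T. \<exists>q\<in>T. \<exists>i\<in>h ` T. agree p q = 2 \<and> (\<forall>r\<in>T. h r \<noteq> i \<longrightarrow> on_line p q r))
    \<or> (\<exists>a b i. distinct [a, b, i] \<and> h ` T = {a, b, i} \<and>
         (\<exists>e. {f \<in> T. h f = a} = {e} \<and> (\<forall>f\<in>T. h f = b \<longrightarrow> agree e f = 2)))
    \<or> (\<exists>a b i. distinct [a, b, i] \<and> h ` T = {a, b, i} \<and>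
         (\<exists>p q r s. {f \<in> T. h f = a} = {p, q} \<and> {f \<in> T. h f = b} = {r, s} \<and> r \<noteq> s \<and> agree p q = 1 \<and>
           agree p r = 2 \<and> agree q r = 2 \<and> agree p s = 2 \<and> agree q s = 2))"
    (is "?line \<or> ?star \<or> ?square")
proof -
  obtain C where "C \<subseteq> h ` T" "card C = 3" using assms by (meson obtain_subset_with_card_n)
  then obtain k1 k2 k3 where k: "k1 \<in> h ` T" "k2 \<in> h ` T" "k3 \<in> h ` T" "k1 \<noteq> k2" "k1 \<noteq> k3" "k2 \<noteq> k3"
    unfolding card_3_iff by (metis insert_subset)
  then obtain a b d where "a \<in> T" "b \<in> T" "d \<in> T" "h a \<noteq> h b" "h a \<noteq> h d" "h b \<noteq> h d"
    by (elim imageE) blast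
  from dominant_colour[OF this] obtain i where i: "i \<in> h ` T"
    and dom: "\<forall>e\<in>T. \<forall>f\<in>T. agree e f = 0 \<longrightarrow> h e \<noteq> h f \<longrightarrow> h e = i \<or> h f = i" ..
  note adj = nondominant_adjacent[OF dom]
  obtain p r where pr: "p \<in> T" "r \<in> T" "h p \<noteq> h r" "h p \<noteq> i" "h r \<noteq> i"
    using k by (metis (no_types, lifting) imageE)
  have pr2: "agree p r = 2" using adj pr by blast
  show ?thesis
  proof (cases "\<exists>t\<in>T. h t \<notin> {h p, h r, i}")
    case True
    then obtain t where t: "t \<in> T" "h t \<noteq> h p" "h t \<noteq> h r" "h t \<noteq> i" by auto
    have ln: "on_line p r t" using on_line_if_adjacent adj pr t by metis
    \<comment> \<open>The colour of \<open>u\<close> differs from those of two of \<open>p\<close>,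
      \<open>r\<close>, \<open>t\<close>, so \<open>u\<close> is on the line through these two, and
      all three span the same line.\<close>
    have "on_line p r u" if u: "u \<in> T" "h u \<noteq> i" for u
    proof -
      consider "h u \<noteq> h p" "h u \<noteq> h r" | "h u \<noteq> h p" "h u \<noteq> h t" | "h u \<noteq> h r" "h u \<noteq> h t"
        using pr t by metis
      then show ?thesis
      proof cases
        case 1
        then show ?thesis using on_line_if_adjacent adj pr u by metis
      next
        case 2
        then have "on_line p t u" using on_line_if_adjacent adj pr t u by metis
        then show ?thesis using on_line_trans[OF pr2 _ ln] on_line_endpoints t by metis
      next
        case 3
        then have "on_line r t u" using on_line_if_adjacent adj pr t u by metis
        then show ?thesis using on_line_trans[OF pr2 _ ln] on_line_endpoints t by metis
      qed
    qed
    then have ?line using pr pr2 i by blast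
    then show ?thesis ..
  next
    case False
    then have cols: "h ` T = {h p, h r, i}" using pr i by blast
    consider (p) "{f \<in> T. h f = h p} = {p}" | (r) "{f \<in> T. h f = h r} = {r}"
      | (both) q s where "q \<in> T" "h q = h p" "q \<noteq> p" "s \<in> T" "h s = h r" "s \<noteq> r"
      using pr by blast
    then show ?thesis
    proof cases
      case p
      have "\<forall>f\<in>T. h f = h r \<longrightarrow> agree p f = 2" using adj pr by metis
      moreover have "distinct [h p, h r, i]" "h ` T = {h p, h r, i}" using pr cols by auto
      ultimately have ?star
        using p by (intro exI conjI)
      then show ?thesis by blast
    next
      case r
      have "\<forall>f\<in>T. h f = h p \<longrightarrow> agree r f = 2" using adj pr by metis
      moreover have "distinct [h r, h p, i]" "h ` T = {h r, h p, i}" using pr cols by auto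
      ultimately have ?star
        using r by (intro exI conjI)
      then show ?thesis by blast
    next
      case both
      have ag: "agree u v = 2" if "u \<in> T" "v \<in> T" "h u = h p" "h v = h r" for u v
        using adj pr that by metis
      \<comment> \<open>An adjacent pair inside one class forces the other class onto its line. Two
        edges of that other class then span the same line, which forces the first class onto it
        too.\<close>
      have line: ?line if uv: "u \<in> T" "v \<in> T" "h u = h v" "u \<noteq> v" "h u \<noteq> i" "agree u v = 2"
        and st: "s \<in> T" "t \<in> T" "h s = h t" "s \<noteq> t" "h s \<noteq> i" "h s \<noteq> h u" for u v s t
      proof -
        have 1: "on_line u v w" if "w \<in> T" "h w \<noteq> i" "h w \<noteq> h u" for w
          using on_line_if_adjacent adj uv that by metis
        have s: "on_line u v s" "on_line u v t" using 1 st by metis+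
        have "agree s t = 2"
          using adjacent_if_on_line \<open>agree u v = 2\<close> s \<open>s \<noteq> t\<close> by blast
        then have "on_line s t w" if "w \<in> T" "h w \<noteq> i" "h w = h u" for w
          using on_line_if_adjacent adj st that by metis
        then have "on_line u v w" if "w \<in> T" "h w \<noteq> i" for w
          using 1 on_line_trans[OF \<open>agree u v = 2\<close> s \<open>s \<noteq> t\<close>] that by metis
        then show ?line using uv i by blast
      qed
      have pq: "agree p q = 1 \<or> agree p q = 2"
        and rs: "agree r s = 1 \<or> agree r s = 2"
        using agree_if_common_neighbour ag pr both agree_commute by metis+
      show ?thesis
      proof (cases "agree p q = 2 \<or> agree r s = 2")
        case True
        then have ?line using line[of p q r s] line[of r s p q] pr both by metis
        then show ?thesis ..
      next
        case False
        then have 1: "agree p q = 1" "agree r s = 1" using pq rs by auto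
        \<comment> \<open>Every edge of one class is a common neighbour of the two known edges of
          the other, and these have only two common neighbours.\<close>
        have "{f \<in> T. h f = h r} = {r, s}"
        proof -
          have "f = r \<or> f = s" if "f \<in> T" "h f = h r" for f
            using common_neighbours_unique[of p q r s f] 1 both pr ag that by metis
          then show ?thesis using pr both by auto
        qed
        moreover have "{f \<in> T. h f = h p} = {p, q}"
        proof -
          have "f = p \<or> f = q" if "f \<in> T" "h f = h p" for f
            using common_neighbours_unique[of r s p q f] 1 both pr ag that agree_commute by metis
          then show ?thesis using pr both by auto
        qed
        moreover have "agree p r = 2" "agree q r = 2" "agree p s = 2" "agree q s = 2"
          using ag pr both by metis+
        moreover have "distinct [h p, h r, i]" using pr by auto
        ultimately have ?square
          using 1(1) both(6)[symmetric] cols by (intro exI conjI)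
        then show ?thesis by blast
      qed
    qed
  qed
qed

end

section \<open>From triples back to the hypergraph\<close>

lemma no_rainbow_path_colours:
  assumes free: "\<not> has_rainbow_copy loose_path E c"
    and dist: "distinct [v1, v2, v3, v4, v5, v6, v7]"
    and E: "{v1, v2, v3} \<in> E" "{v3, v4, v5} \<in> E" "{v5, v6, v7} \<in> E"
  shows "\<not> distinct [c {v1, v2, v3}, c {v3, v4, v5}, c {v5, v6, v7}]"
proof
  assume d: "distinct [c {v1, v2, v3}, c {v3, v4, v5}, c {v5, v6, v7}]"
  \<comment> \<open>The path numbers its vertices from 1, while list positions start at 0.\<close>
  define \<phi> where "\<phi> = (\<lambda>n::nat. [v1, v2, v3, v4, v5, v6, v7] ! (n - 1))"
  have [simp]: "\<phi> 1 = v1" "\<phi> (Suc 0) = v1" "\<phi> 2 = v2" "\<phi> 3 = v3" "\<phi> 4 = v4" "\<phi> 5 = v5" "\<phi> 6 = v6" "\<phi> 7 = v7"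
    by (simp_all add: \<phi>_def)
  have "is_copy loose_path E \<phi>"
    using dist E unfolding is_copy_def loose_path_def by (auto simp: inj_on_def)
  moreover have "inj_on c ((`) \<phi> ` loose_path)"
    using d unfolding loose_path_def by (auto simp: inj_on_def)
  ultimately show False using free unfolding has_rainbow_copy_def by blast
qed

lemma tripartite_loose_path_free:
  assumes disj: "V1 \<inter> V2 = {}" "V1 \<inter> V3 = {}" "V2 \<inter> V3 = {}"
    and card: "card V1 \<ge> 3" "card V2 \<ge> 3" "card V3 \<ge> 3"
    and free: "\<not> has_rainbow_copy loose_path (complete_tripartite V1 V2 V3) c"
  shows "loose_path_free V1 V2 V3 (\<lambda>(x, y, z). c {x, y, z})"
proof
  fix p q r
  assume asm: "p \<in> V1 \<times> V2 \<times> V3" "q \<in> V1 \<times> V2 \<times> V3" "r \<in> V1 \<times> V2 \<times> V3"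
    "agree p q = 1" "agree q r = 1" "agree p r = 0"
    "(\<lambda>(x, y, z). c {x, y, z}) p \<noteq> (\<lambda>(x, y, z). c {x, y, z}) q"
    "(\<lambda>(x, y, z). c {x, y, z}) q \<noteq> (\<lambda>(x, y, z). c {x, y, z}) r"
  obtain p1 p2 p3 q1 q2 q3 r1 r2 r3 where
    pqr: "p = (p1, p2, p3)" "q = (q1, q2, q3)" "r = (r1, r2, r3)"
    by (metis prod_cases3)
  note path = no_rainbow_path_colours[OF free]
  have edge: "{x, y, z} \<in> complete_tripartite V1 V2 V3" if "x \<in> V1" "y \<in> V2" "z \<in> V3" for x y z
    using that unfolding complete_tripartite_def by blast
  have mem: "p1 \<in> V1" "q1 \<in> V1" "r1 \<in> V1" "p2 \<in> V2" "q2 \<in> V2" "r2 \<in> V2" "p3 \<in> V3" "q3 \<in> V3" "r3 \<in> V3"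
    using asm pqr by auto
  have parts: "x \<noteq> y" "x \<noteq> z" "y \<noteq> z" "y \<noteq> x" "z \<noteq> x" "z \<noteq> y" if "x \<in> V1" "y \<in> V2" "z \<in> V3" for x y z
    using that disj by auto
  have ne: "p1 \<noteq> r1" "p2 \<noteq> r2" "p3 \<noteq> r3" using asm(6) unfolding pqr agree_eq_iffs by blast+
  have col: "c {p1, p2, p3} \<noteq> c {q1, q2, q3}" "c {q1, q2, q3} \<noteq> c {r1, r2, r3}" using asm pqr by auto
  note * = edge[OF mem(1,4,7)] edge[OF mem(2,5,8)] edge[OF mem(3,6,9)] ne col parts
  \<comment> \<open>As \<open>p\<close> and \<open>r\<close> are disjoint, \<open>q\<close> meets
    them in different coordinates, which leaves six choices. In each the two shared vertices become
    the third and fifth of the path, and the remaining vertex of \<open>q\<close> the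
    fourth.\<close>
  consider "p1 = q1" "q2 = r2" "p2 \<noteq> q2" "p3 \<noteq> q3" "q1 \<noteq> r1" "q3 \<noteq> r3"
    | "p1 = q1" "q3 = r3" "p3 \<noteq> q3" "p2 \<noteq> q2" "q1 \<noteq> r1" "q2 \<noteq> r2"
    | "p2 = q2" "q1 = r1" "p1 \<noteq> q1" "p3 \<noteq> q3" "q2 \<noteq> r2" "q3 \<noteq> r3"
    | "p2 = q2" "q3 = r3" "p3 \<noteq> q3" "p1 \<noteq> q1" "q2 \<noteq> r2" "q1 \<noteq> r1"
    | "p3 = q3" "q1 = r1" "p1 \<noteq> q1" "p2 \<noteq> q2" "q3 \<noteq> r3" "q2 \<noteq> r2"
    | "p3 = q3" "q2 = r2" "p2 \<noteq> q2" "p1 \<noteq> q1" "q3 \<noteq> r3" "q1 \<noteq> r1"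
    using asm(4-6) unfolding pqr agree_eq_iffs by metis
  then have "c {p1, p2, p3} = c {r1, r2, r3}"
  proof cases
    case 1
    then show ?thesis
      using path[of p2 p3 q1 q3 q2 r1 r3] * mem by (auto simp: insert_commute)
  next
    case 2
    then show ?thesis
      using path[of p3 p2 q1 q2 q3 r1 r2] * mem by (auto simp: insert_commute)
  next
    case 3
    then show ?thesis
      using path[of p1 p3 q2 q3 q1 r2 r3] * mem by (auto simp: insert_commute)
  next
    case 4
    then show ?thesis
      using path[of p3 p1 q2 q1 q3 r2 r1] * mem by (auto simp: insert_commute)
  next
    case 5
    then show ?thesis
      using path[of p1 p2 q3 q2 q1 r3 r2] * mem by (auto simp: insert_commute)
  next
    case 6
    then show ?thesis
      using path[of p2 p1 q3 q1 q2 r3 r1] * mem by (auto simp: insert_commute)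
  qed
  then show "(\<lambda>(x, y, z). c {x, y, z}) p = (\<lambda>(x, y, z). c {x, y, z}) r"
    using pqr by simp
qed (use card in auto)

theorem theorem1p15:
  fixes n :: nat and V1 V2 V3 :: "'v set" and G :: "'v set set" and c :: "'v set \<Rightarrow> 'c"
  assumes "n \<ge> 3"
    and "V1 \<inter> V2 = {}" and "V1 \<inter> V3 = {}" and "V2 \<inter> V3 = {}"
    and "card V1 = n" and "card V2 = n" and "card V3 = n"
    and "G = complete_tripartite V1 V2 V3"
    and "\<not> has_rainbow_copy loose_path G c"
    and "card (colors c G) \<ge> 3"
  shows
    "(\<exists>x1 \<in> V1 \<union> V2 \<union> V3. \<exists>y1 \<in> V1 \<union> V2 \<union> V3. \<exists>i \<in> colors c G.
        x1 \<noteq> y1 \<and> (\<forall>e \<in> G. c e \<noteq> i \<longrightarrow> {x1, y1} \<subseteq> e))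
     \<or> (card (colors c G) = 3 \<and>
        (\<exists>k1 k2 k3. distinct [k1, k2, k3] \<and> colors c G = {k1, k2, k3} \<and>
          (\<exists>e. {f \<in> G. c f = k1} = {e} \<and>
             (\<forall>f \<in> G. c f = k2 \<longrightarrow> card (e \<inter> f) = 2))))
     \<or> (card (colors c G) = 3 \<and>
        (\<exists>k1 k2 k3. distinct [k1, k2, k3] \<and> colors c G = {k1, k2, k3} \<and>
          (\<exists>x1 y1 y2 z1 z2. distinct [x1, y1, y2, z1, z2] \<and>
             {{x1, y1, z1}, {x1, y2, z2}, {x1, y1, z2}, {x1, y2, z1}} \<subseteq> G \<and>
             c {x1, y1, z1} = k1 \<and> c {x1, y2, z2} = k1 \<and>
             c {x1, y1, z2} = k2 \<and> c {x1, y2, z1} = k2 \<and>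
             (\<forall>f \<in> G - {{x1, y1, z1}, {x1, y2, z2}, {x1, y1, z2}, {x1, y2, z1}}. c f = k3))))"
proof -
  define h where "h = (\<lambda>(x, y, z). c {x, y, z})"
  define E :: "'v \<times> 'v \<times> 'v \<Rightarrow> 'v set" where "E = (\<lambda>(x, y, z). {x, y, z})"
  have E [simp]: "E (x, y, z) = {x, y, z}" for x y z by (simp add: E_def)
  interpret loose_path_free V1 V2 V3 h
    unfolding h_def using assms by (intro tripartite_loose_path_free) auto
  have G: "G = E ` T"
    unfolding assms(8) complete_tripartite_def by (auto simp: T_def E_def image_def)
  have hE: "h p = c (E p)" for p by (simp add: h_def E_def case_prod_beta)
  have col: "colors c G = h ` T"
    unfolding colors_def G image_image hE ..
  \<comment> \<open>Vertices of different parts never coincide, so intersections are read off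
    coordinate by coordinate.\<close>
  have inter: "E (x, y, z) \<inter> E (x', y', z') =
      (if x = x' then {x} else {}) \<union> (if y = y' then {y} else {}) \<union> (if z = z' then {z} else {})"
    if "(x, y, z) \<in> T" "(x', y', z') \<in> T" for x y z x' y' z'
    using that assms(2-4) by (auto simp: T_def)
  have card_inter: "card (E p \<inter> E q) = agree p q" if "p \<in> T" "q \<in> T" for p q
  proof -
    obtain x y z x' y' z' where pq: "p = (x, y, z)" "q = (x', y', z')" by (metis prod_cases3)
    show ?thesis
      using inter[of x y z x' y' z'] that assms(2-4) unfolding pq
      by (auto simp: T_def of_bool_def card_insert_if)
  qed
  have inter_on_line: "E p \<inter> E q \<subseteq> E r" if "p \<in> T" "q \<in> T" "on_line p q r" for p q r
  proof -
    obtain x y z x' y' z' where pq: "p = (x, y, z)" "q = (x', y', z')" by (metis prod_cases3)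
    show ?thesis
      using inter[of x y z x' y' z'] that unfolding pq
      by (cases r) (auto split: if_splits)
  qed
  from classification[folded col, OF assms(10)] show ?thesis
  proof (elim disjE, goal_cases)
    case 1
    then obtain p q i where pq: "p \<in> T" "q \<in> T" "i \<in> colors c G" "agree p q = 2"
      "\<And>r. r \<in> T \<Longrightarrow> h r \<noteq> i \<Longrightarrow> on_line p q r" by metis
    \<comment> \<open>The two vertices shared by \<open>p\<close> and \<open>q\<close> lie in every
      edge on their line and serve as the required pair.\<close>
    then obtain u v where uv: "E p \<inter> E q = {u, v}" "u \<noteq> v"
      using card_inter by (metis card_2_iff)
    then have "{u, v} \<subseteq> E p" by blast
    then have "u \<in> V1 \<union> V2 \<union> V3" "v \<in> V1 \<union> V2 \<union> V3" using pq(1) by (auto simp: T_def E_def)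
    moreover have "\<forall>e\<in>G. c e \<noteq> i \<longrightarrow> {u, v} \<subseteq> e"
    proof (intro ballI impI)
      fix e assume e: "e \<in> G" "c e \<noteq> i"
      obtain r where r: "r \<in> T" "e = E r" using e(1) unfolding G by blast
      then have "on_line p q r" using pq(5) e(2) hE by metis
      then show "{u, v} \<subseteq> e" using inter_on_line pq(1,2) r(2) uv(1) by metis
    qed
    ultimately show ?case
      using pq(3) uv(2) by (intro disjI1 bexI conjI)
  next
    case 2
    then obtain a b i e where abi: "distinct [a, b, i]" "colors c G = {a, b, i}"
      and e: "{f \<in> T. h f = a} = {e}" and f: "\<forall>f\<in>T. h f = b \<longrightarrow> agree e f = 2"
      by (elim exE conjE) (rule that)
    have "card (colors c G) = 3" using abi by simp
    have "e \<in> T" using e by blast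
    have "{f \<in> G. c f = a} = E ` {f \<in> T. h f = a}"
      unfolding G hE by blast
    then have "{f \<in> G. c f = a} = {E e}" unfolding e by simp
    moreover have "\<forall>g\<in>G. c g = b \<longrightarrow> card (E e \<inter> g) = 2"
      using f card_inter[OF \<open>e \<in> T\<close>] hE unfolding G by (metis imageE)
    ultimately show ?case
      using abi \<open>card (colors c G) = 3\<close> by (intro disjI2[OF disjI1] conjI exI)
  next
    case 3
    then obtain a b i p q r s where abi: "distinct [a, b, i]" "colors c G = {a, b, i}"
      and pq: "{f \<in> T. h f = a} = {p, q}" and rs: "{f \<in> T. h f = b} = {r, s}"
      and ag: "r \<noteq> s" "agree p q = 1" "agree p r = 2" "agree q r = 2" "agree p s = 2" "agree q s = 2"
      by (elim exE conjE) (rule that)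
    have c3: "card (colors c G) = 3" using abi by simp
    have mem: "p \<in> T" "q \<in> T" "r \<in> T" "s \<in> T" using pq rs by blast+
    have ha: "c (E p) = a" "c (E q) = a" "c (E r) = b" "c (E s) = b"
      unfolding hE[symmetric] using pq rs by blast+
    have rest: "c f = i" if f: "f \<in> G - {E p, E q, E r, E s}" for f
    proof -
      obtain t where t: "t \<in> T" "f = E t" using f unfolding G by blast
      have "t \<notin> {p, q}" "t \<notin> {r, s}" using f t(2) by auto
      then have "h t \<noteq> a" "h t \<noteq> b" using t(1) unfolding pq[symmetric] rs[symmetric] by blast+
      moreover have "h t \<in> {a, b, i}" using t col abi(2) by blast
      ultimately show ?thesis using t hE by auto
    qed
    have EG: "E p \<in> G" "E q \<in> G" "E r \<in> G" "E s \<in> G" using mem unfolding G by blast+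
    \<comment> \<open>The vertex \<open>x1\<close> is the one shared by \<open>p\<close> and
      \<open>q\<close>, so its part depends on the case. Which of \<open>r\<close> and
      \<open>s\<close> is which mixture stays open; both have colour \<open>b\<close>.\<close>
    have "\<exists>x1 y1 y2 z1 z2. distinct [x1, y1, y2, z1, z2] \<and> E p = {x1, y1, z1} \<and> E q = {x1, y2, z2} \<and>
        ({E r, E s} = {{x1, y1, z2}, {x1, y2, z1}})"
    proof -
      obtain p1 p2 p3 q1 q2 q3 where pqrs: "p = (p1, p2, p3)" "q = (q1, q2, q3)"
        by (metis prod_cases3)
      from ag(2,1,3-6)[unfolded pqrs] show ?thesis
      proof (cases rule: common_neighbours_cases)
        case 1
        from 1(4) have "E ` {r, s} = {{p1, p2, q3}, {p1, q2, p3}}" by (simp add: insert_commute)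
        then have "{E r, E s} = {{p1, p2, q3}, {p1, q2, p3}}" by simp
        moreover have "distinct [p1, p2, q2, p3, q3]"
          using 1(2,3) mem(1,2) assms(2-4) unfolding pqrs T_def by auto
        moreover have "E p = {p1, p2, p3}" "E q = {p1, q2, q3}" using 1(1) unfolding pqrs by auto
        ultimately show ?thesis by (intro exI conjI)
      next
        case 2
        from 2(4) have "E ` {r, s} = {{p2, p1, q3}, {p2, q1, p3}}" by (simp add: insert_commute)
        then have "{E r, E s} = {{p2, p1, q3}, {p2, q1, p3}}" by simp
        moreover have "distinct [p2, p1, q1, p3, q3]"
          using 2(2,3) mem(1,2) assms(2-4) unfolding pqrs T_def by auto
        moreover have "E p = {p2, p1, p3}" "E q = {p2, q1, q3}" using 2(1) unfolding pqrs by auto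
        ultimately show ?thesis by (intro exI conjI)
      next
        case 3
        from 3(4) have "E ` {r, s} = {{p3, p1, q2}, {p3, q1, p2}}" by (simp add: insert_commute)
        then have "{E r, E s} = {{p3, p1, q2}, {p3, q1, p2}}" by simp
        moreover have "distinct [p3, p1, q1, p2, q2]"
          using 3(2,3) mem(1,2) assms(2-4) unfolding pqrs T_def by auto
        moreover have "E p = {p3, p1, p2}" "E q = {p3, q1, q2}" using 3(1) unfolding pqrs by auto
        ultimately show ?thesis by (intro exI conjI)
      qed
    qed
    then obtain x1 y1 y2 z1 z2 where x: "distinct [x1, y1, y2, z1, z2]" "E p = {x1, y1, z1}" "E q = {x1, y2, z2}"
      and rs': "{E r, E s} = {{x1, y1, z2}, {x1, y2, z1}}"
      by (elim exE conjE) (rule that)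
    have sets: "{E p, E q, E r, E s} = {{x1, y1, z1}, {x1, y2, z2}, {x1, y1, z2}, {x1, y2, z1}}"
      unfolding x(2,3) rs' ..
    have "c ` {E r, E s} = {b}" using ha by simp
    then have "c {x1, y1, z2} = b" "c {x1, y2, z1} = b"
      unfolding rs' by auto
    moreover have "c {x1, y1, z1} = a" "c {x1, y2, z2} = a" using ha(1,2) unfolding x(2,3) .
    moreover have "{{x1, y1, z1}, {x1, y2, z2}, {x1, y1, z2}, {x1, y2, z1}} \<subseteq> G"
      unfolding sets[symmetric] using EG by simp
    moreover have "\<forall>f \<in> G - {{x1, y1, z1}, {x1, y2, z2}, {x1, y1, z2}, {x1, y2, z1}}. c f = i"
      unfolding sets[symmetric] using rest by (rule ballI)
    ultimately show ?case
      using abi c3 x(1) by (intro disjI2[OF disjI2] conjI exI)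
  qed
qed

end
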